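(* Consider the classical secretary problem in the comparison model: candidates with a uniformly random relative ranking (all orderings of distinct values equally likely) arrive one by one, the algorithm observes only the relative ranks of candidates seen so far, and must irrevocably select at most one candidate, with the goal of selecting the best among the first $n$ candidates. The number $n$ is chosen by an adversary from $\{1,\dots,N\}$, where $N$ is known in advance but $n$ is not (the algorithm learns nothing about $n$ before the input ends). Then there is a randomized algorithm which, for every $n\in\{1,\dots,N\}$, selects the best of the first $n$ candidates with probability at least $1/(H_{N-1}+1)$. On the other hand, no algorithm in this setting selects the best candidate with probability more than $1/H_N$ for every $n\in\{1,\dots,N\}$. Here $H_N=\sum_{i=1}^N\frac1i$. *)

theory Defs
  imports "HOL-Probability.Probability" "HOL-Combinatorics.Multiset_Permutations"
begin

text \<open>
  An input is a list \<open>xs\<close> of distinct values in order of arrival; larger values are better.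
  In \<open>rel_ranks xs\<close> every candidate is replaced by its rank within \<open>xs\<close> (rank 1 is the best), so
  after the first \<open>t\<close> arrivals an algorithm in the comparison model knows exactly
  \<open>rel_ranks (take t xs)\<close>; this also determines everything that was observed earlier.
\<close>

definition rel_ranks :: "nat list \<Rightarrow> nat list" where
  "rel_ranks xs = map (\<lambda>x. card {y \<in> set xs. x \<le> y}) xs"

text \<open>
  A deterministic algorithm is a predicate \<open>d\<close> on observations: \<open>d h\<close> means that, after observing
  \<open>h\<close>, the most recent candidate is selected unless a selection was already made.
  Candidates are indexed from 0, so candidate \<open>t\<close> arrives as number \<open>t + 1\<close>.
\<close>

definition selects :: "(nat list \<Rightarrow> bool) \<Rightarrow> nat list \<Rightarrow> nat \<Rightarrow> bool" where
  "selects d xs t \<longleftrightarrow> t < length xs \<and> d (rel_ranks (take (Suc t) xs)) \<and>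
     (\<forall>s<t. \<not> d (rel_ranks (take (Suc s) xs)))"

text \<open>
  The input ends after \<open>n\<close> candidates. As \<open>d\<close> does not depend on \<open>n\<close>, the end is not announced,
  and an algorithm that has selected nobody by then loses.
\<close>

definition selects_best :: "(nat list \<Rightarrow> bool) \<Rightarrow> nat \<Rightarrow> nat list \<Rightarrow> bool" where
  "selects_best d n xs \<longleftrightarrow> (\<exists>t<n. selects d xs t \<and> xs ! t = Max (set (take n xs)))"

text \<open>
  A randomized algorithm draws a random seed from an arbitrary probability space \<open>M\<close>, independently
  of the input, and runs the deterministic algorithm given by the seed.
\<close>

definition randomized_algorithm :: "'w measure \<Rightarrow> ('w \<Rightarrow> nat list \<Rightarrow> bool) \<Rightarrow> bool" where
  "randomized_algorithm M A \<longleftrightarrow> prob_space M \<and> (\<forall>h. {w \<in> space M. A w h} \<in> sets M)"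

definition arrival_order :: "nat \<Rightarrow> nat list pmf" where
  "arrival_order N = pmf_of_set (permutations_of_set {1..N})"

definition success_prob :: "nat \<Rightarrow> 'w measure \<Rightarrow> ('w \<Rightarrow> nat list \<Rightarrow> bool) \<Rightarrow> nat \<Rightarrow> real" where
  "success_prob N M A n = measure (M \<Otimes>\<^sub>M measure_pmf (arrival_order N))
     {(w, xs). w \<in> space M \<and> selects_best (A w) n xs}"

text \<open>The success event is measurable, so \<^const>\<open>success_prob\<close> is a genuine probability.\<close>

lemma success_event_measurable:
  assumes "randomized_algorithm M A"
  shows "{(w, xs). w \<in> space M \<and> selects_best (A w) n xs}
           \<in> sets (M \<Otimes>\<^sub>M measure_pmf (arrival_order N))"
proof -
  have [measurable]: "Measurable.pred M (\<lambda>w. A w h)" for h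
    using assms by (auto simp: randomized_algorithm_def pred_def)
  have *: "{w \<in> space M. selects_best (A w) n xs} \<in> sets M" for xs
    unfolding selects_best_def selects_def by measurable
  have "{(w, xs). w \<in> space M \<and> selects_best (A w) n xs} =
        (\<Union>xs. {w \<in> space M. selects_best (A w) n xs} \<times> {xs})"
    by auto
  also have "\<dots> \<in> sets (M \<Otimes>\<^sub>M measure_pmf (arrival_order N))"
    using * by (intro sets.countable_UN' pair_measureI) auto
  finally show ?thesis .
qed

end

theory Submission imports Defs begin

text \<open>
  Let \<open>S n\<close> be the probability of selecting the best of the first \<open>n\<close> candidates, and \<open>a t\<close> the
  probability of selecting candidate \<open>t\<close> (counted from 0) when it is the best so far. Candidate
  \<open>n\<close> is the best so far with probability \<open>1 / (n + 1)\<close>, independently of the relative order of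
  the earlier ones, so \<open>S (n + 1) = S n * n / (n + 1) + a n\<close>.

  Upper bound: summing this recurrence gives
  \<open>(\<Sum>n=1..<N. S n / (n + 1)) + S N = (\<Sum>t<N. a t) \<le> 1\<close>, where the weights on the left add up to
  the harmonic number of \<open>N\<close>.

  Algorithm: skip a random number \<open>k\<close> of candidates, then take the first one that is the best so
  far. For \<open>1 \<le> k \<le> t\<close> this has \<open>a t = k / (t * (t + 1))\<close>. Choosing \<open>k\<close> with probability \<open>p / k\<close>,
  and \<open>k = 0\<close> with probability \<open>p\<close>, makes \<open>a t = p / (t + 1)\<close> and hence \<open>S n = p\<close> for all \<open>n\<close>;
  the probabilities add up to 1 for \<open>p = 1 / (harm (N - 1) + 1)\<close>.
\<close>

subsection \<open>Order isomorphism\<close>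

text \<open>
  In contrast to \<^const>\<open>rel_ranks\<close>, which reverses the order, this yields an order-isomorphic list,
  so that it can be iterated and fed to the algorithm in place of the original input.
\<close>

definition standardize :: "nat list \<Rightarrow> nat list" where
  "standardize xs = map (\<lambda>x. card {y \<in> set xs. y \<le> x}) xs"

definition record_at :: "nat list \<Rightarrow> nat \<Rightarrow> bool" where
  "record_at xs t \<longleftrightarrow> xs ! t = Max (set (take (Suc t) xs))"

text \<open>The larger element counts itself, so the counted sets are strictly nested. Hence
  \<open>standardize\<close> maps along a strictly increasing function.\<close>

lemma strict_mono_on_card_le:
  assumes "finite A"
  shows "strict_mono_on A (\<lambda>x::nat. card {y \<in> A. y \<le> x})"
proof (rule strict_mono_onI)
  fix r s assume "r \<in> A" "s \<in> A" "r < s"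
  then have "{y \<in> A. y \<le> r} \<subseteq> {y \<in> A. y \<le> s}" "s \<in> {y \<in> A. y \<le> s}" "s \<notin> {y \<in> A. y \<le> r}"
    by auto
  then have "{y \<in> A. y \<le> r} \<subset> {y \<in> A. y \<le> s}"
    by blast
  then show "card {y \<in> A. y \<le> r} < card {y \<in> A. y \<le> s}"
    using assms by (intro psubset_card_mono) auto
qed

lemma image_card_le:
  assumes "finite (A :: nat set)"
  shows "(\<lambda>x. card {y \<in> A. y \<le> x}) ` A = {1..card A}"
proof (rule card_subset_eq)
  show "(\<lambda>x. card {y \<in> A. y \<le> x}) ` A \<subseteq> {1..card A}"
  proof safe
    fix x assume "x \<in> A"
    then have "card {x} \<le> card {y \<in> A. y \<le> x}" "card {y \<in> A. y \<le> x} \<le> card A"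
      using assms by (intro card_mono; auto)+
    then show "card {y \<in> A. y \<le> x} \<in> {1..card A}"
      by simp
  qed
  show "card ((\<lambda>x. card {y \<in> A. y \<le> x}) ` A) = card {1..card A}"
    using strict_mono_on_card_le[OF assms, THEN strict_mono_on_imp_inj_on]
    by (simp add: card_image)
qed simp

text \<open>All orderings of \<open>A\<close> have the same set of entries, so on them
  \<open>standardize\<close> is \<open>map\<close> of one fixed injection of \<open>A\<close> onto
  \<open>{1..card A}\<close>.\<close>

lemma standardize_bij_betw:
  assumes "finite A"
  shows "bij_betw standardize (permutations_of_set A) (permutations_of_set {1..card A})"
proof -
  let ?f = "\<lambda>x. card {y \<in> A. y \<le> x}"
  have inj: "inj_on ?f A"
    using strict_mono_on_card_le[OF assms] by (rule strict_mono_on_imp_inj_on)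
  have "bij_betw (map ?f) (permutations_of_set A) (permutations_of_set {1..card A})"
  proof (rule bij_betw_imageI)
    show "inj_on (map ?f) (permutations_of_set A)"
      by (intro inj_on_mapI inj_on_subset[OF inj]) (auto simp: permutations_of_set_def)
    show "map ?f ` permutations_of_set A = permutations_of_set {1..card A}"
      using permutations_of_set_image_inj[OF inj] image_card_le[OF assms] by simp
  qed
  then show ?thesis
    by (rule iffD1[OF bij_betw_cong, rotated])
      (auto simp: standardize_def permutations_of_set_def)
qed

lemma strict_mono_on_le_iff:
  fixes f :: "'a::linorder \<Rightarrow> 'b::linorder"
  assumes "strict_mono_on A f" "x \<in> A" "y \<in> A"
  shows "f x \<le> f y \<longleftrightarrow> x \<le> y"
  by (metis assms linorder_not_less order_less_imp_le strict_mono_onD order_le_less)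

text \<open>An order embedding carries each counted set bijectively onto its counterpart:
  observations reveal nothing beyond relative order.\<close>

lemma rel_ranks_map:
  assumes "strict_mono_on (set xs) f"
  shows "rel_ranks (map f xs) = rel_ranks xs"
proof -
  have "card {y \<in> f ` set xs. f x \<le> y} = card {y \<in> set xs. x \<le> y}" if "x \<in> set xs" for x
  proof -
    have "{y \<in> f ` set xs. f x \<le> y} = f ` {y \<in> set xs. x \<le> y}"
      using that strict_mono_on_le_iff[OF assms] by auto
    moreover have "inj_on f {y \<in> set xs. x \<le> y}"
      using strict_mono_on_imp_inj_on[OF assms] by (rule inj_on_subset) auto
    ultimately show ?thesis
      by (simp add: card_image)
  qed
  then show ?thesis
    by (simp add: rel_ranks_def)
qed

lemma standardize_map:
  assumes "strict_mono_on (set xs) f"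
  shows "standardize (map f xs) = standardize xs"
proof -
  have "card {y \<in> f ` set xs. y \<le> f x} = card {y \<in> set xs. y \<le> x}" if "x \<in> set xs" for x
  proof -
    have "{y \<in> f ` set xs. y \<le> f x} = f ` {y \<in> set xs. y \<le> x}"
      using that strict_mono_on_le_iff[OF assms] by auto
    moreover have "inj_on f {y \<in> set xs. y \<le> x}"
      using strict_mono_on_imp_inj_on[OF assms] by (rule inj_on_subset) auto
    ultimately show ?thesis
      by (simp add: card_image)
  qed
  then show ?thesis
    by (simp add: standardize_def)
qed

lemma strict_mono_on_take:
  "strict_mono_on (set xs) f \<Longrightarrow> strict_mono_on (set (take n xs)) f"
  by (erule monotone_on_subset) (rule set_take_subset)

text \<open>The inner standardization only relabels the prefix increasingly, which the outer one
  cannot see. Hence standardized prefixes may be formed in stages.\<close>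

lemma standardize_take_standardize:
  "standardize (take n (standardize xs)) = standardize (take n xs)"
  unfolding standardize_def[of xs]
  by (simp add: take_map strict_mono_on_take strict_mono_on_card_le standardize_map)

lemma length_standardize [simp]: "length (standardize xs) = length xs"
  by (simp add: standardize_def)

section \<open>Maxima, selections and records under order isomorphism\<close>

lemma nth_eq_Max_iff:
  assumes "t < n" "t < length xs"
  shows "xs ! t = Max (set (take n xs)) \<longleftrightarrow> (\<forall>x\<in>set (take n xs). x \<le> xs ! t)"
proof -
  have "xs ! t \<in> set (take n xs)"
    using assms by (auto simp: in_set_conv_nth intro!: exI[of _ t])
  then show ?thesis
    by (auto intro: Max_eqI[symmetric])
qed

lemma nth_eq_Max_map:
  assumes "strict_mono_on (set xs) f" "t < n" "t < length xs"
  shows "map f xs ! t = Max (set (take n (map f xs))) \<longleftrightarrow> xs ! t = Max (set (take n xs))"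
proof -
  have "(\<forall>x\<in>set (take n xs). f x \<le> f (xs ! t)) \<longleftrightarrow> (\<forall>x\<in>set (take n xs). x \<le> xs ! t)"
    using assms
    by (intro ball_cong strict_mono_on_le_iff[OF assms(1)] refl) (auto dest: in_set_takeD)
  then show ?thesis
    using assms by (subst (1 2) nth_eq_Max_iff) (auto simp: take_map)
qed

lemma selects_map:
  assumes "strict_mono_on (set xs) f"
  shows "selects d (map f xs) t \<longleftrightarrow> selects d xs t"
  using assms by (simp add: selects_def take_map rel_ranks_map strict_mono_on_take)

lemma selects_take: "t < n \<Longrightarrow> selects d (take n xs) t \<longleftrightarrow> selects d xs t"
  by (auto simp: selects_def min_def)

text \<open>Both the observations and the comparison with the maximum depend only on the relative
  order of the first \<open>n\<close> entries. This supplies the invariance required of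
  \<open>Q\<close> in \<open>prob_not_record_at\<close>.\<close>

lemma selects_best_standardize_take:
  "selects_best d n (standardize (take n xs)) \<longleftrightarrow> selects_best d n xs"
proof -
  have "selects_best d n (standardize zs) \<longleftrightarrow> selects_best d n zs" for zs
  proof -
    have mono: "strict_mono_on (set zs) (\<lambda>x. card {y \<in> set zs. y \<le> x})"
      by (simp add: strict_mono_on_card_le)
    \<comment> \<open>The comparison with the maximum transfers only for positions inside the list;
      \<open>selects\<close> guarantees this even when \<open>n\<close> exceeds the length.\<close>
    have "t < length zs" if "selects d zs t" for t
      using that by (simp add: selects_def)
    then show ?thesis
      unfolding selects_best_def standardize_def selects_map[OF mono]
      using nth_eq_Max_map[OF mono, of _ n] by blast
  qed
  moreover have "selects_best d n (take n xs) \<longleftrightarrow> selects_best d n xs"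
    by (auto simp: selects_best_def selects_take)
  ultimately show ?thesis
    by simp
qed

lemma record_at_take: "t < n \<Longrightarrow> record_at (take n xs) t \<longleftrightarrow> record_at xs t"
  by (simp add: record_at_def min_def)

lemma record_at_standardize:
  "t < length xs \<Longrightarrow> record_at (standardize xs) t \<longleftrightarrow> record_at xs t"
  unfolding record_at_def standardize_def
  by (intro nth_eq_Max_map strict_mono_on_card_le) auto

lemma record_at_iff:
  "t < length xs \<Longrightarrow> record_at xs t \<longleftrightarrow> (\<forall>x\<in>set (take t xs). x \<le> xs ! t)"
  unfolding record_at_def by (subst nth_eq_Max_iff) (auto simp: take_Suc_conv_app_nth)

text \<open>Rank 1 means that the newest candidate is the only one seen that is at least as large as
  itself; thus records can be recognized from observations.\<close>

lemma last_rel_ranks_eq_1_iff: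
  assumes "t < length xs"
  shows "last (rel_ranks (take (Suc t) xs)) = 1 \<longleftrightarrow> record_at xs t"
proof -
  let ?S = "set (take (Suc t) xs)"
  have in_S: "xs ! t \<in> ?S"
    using assms by (simp add: take_Suc_conv_app_nth)
  have "last (rel_ranks (take (Suc t) xs)) = card {y \<in> ?S. xs ! t \<le> y}"
    using assms by (simp add: rel_ranks_def last_map take_Suc_conv_app_nth)
  also have "\<dots> = 1 \<longleftrightarrow> {y \<in> ?S. xs ! t \<le> y} = {xs ! t}"
  proof -
    have "card T = 1 \<longleftrightarrow> T = {a}" if "a \<in> T" for a and T :: "nat set"
      using that by (auto simp: card_1_singleton_iff)
    then show ?thesis
      using in_S by simp
  qed
  also have "\<dots> \<longleftrightarrow> (\<forall>x\<in>?S. x \<le> xs ! t)"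
  proof -
    have "{y \<in> T. a \<le> y} = {a} \<longleftrightarrow> (\<forall>x\<in>T. x \<le> a)" if "a \<in> T" for a and T :: "nat set"
      using that by (auto simp: set_eq_iff)
    then show ?thesis
      using in_S by blast
  qed
  also have "\<dots> \<longleftrightarrow> record_at xs t"
    using assms by (simp add: record_at_def nth_eq_Max_iff)
  finally show ?thesis .
qed

text \<open>A record at \<open>m\<close> displaces every earlier best candidate, so only selecting
  \<open>m\<close> wins; otherwise the previous maximum stays. Distinctness rules out a tie with the
  newcomer.\<close>

lemma selects_best_Suc:
  assumes "distinct xs" "m < length xs"
  shows "selects_best d (Suc m) xs \<longleftrightarrow>
    (selects_best d m xs \<and> \<not> record_at xs m) \<or> (selects d xs m \<and> record_at xs m)"
proof -
  have "xs ! t = Max (set (take (Suc m) xs)) \<longleftrightarrow>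
      xs ! t = Max (set (take m xs)) \<and> \<not> record_at xs m" if "t < m" for t
  proof -
    have in_T: "xs ! t \<in> set (take m xs)" "xs ! t \<noteq> xs ! m"
      using that assms by (auto simp: in_set_conv_nth nth_eq_iff_index_eq intro!: exI[of _ t])
    have Max_iff: "xs ! t = Max (set (take n xs)) \<longleftrightarrow> (\<forall>x\<in>set (take n xs). x \<le> xs ! t)"
      if "t < n" for n
      using that \<open>t < m\<close> assms by (intro nth_eq_Max_iff) auto
    have "(\<forall>x\<in>insert b T. x \<le> a) \<longleftrightarrow> (\<forall>x\<in>T. x \<le> a) \<and> \<not> (\<forall>x\<in>T. x \<le> b)"
      if "a \<in> T" "a \<noteq> b" for a b and T :: "nat set"
    proof (cases "b \<le> a")
      case True
      with that have "\<not> a \<le> b"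
        by simp
      with True that show ?thesis
        by auto
    next
      case False
      then show ?thesis
        by (auto intro: order_trans[of _ a b])
    qed
    moreover have "set (take (Suc m) xs) = insert (xs ! m) (set (take m xs))"
      using assms by (simp add: take_Suc_conv_app_nth)
    ultimately show ?thesis
      unfolding record_at_iff[OF assms(2)] Max_iff[OF that] Max_iff[OF less_SucI[OF that]]
      by (simp only: in_T not_False_eq_True)
  qed
  then show ?thesis
    unfolding selects_best_def less_Suc_eq by (auto simp: record_at_def)
qed

subsection \<open>Independence of records from the past\<close>

lemma set_pmf_arrival_order: "set_pmf (arrival_order N) = permutations_of_set {1..N}"
  by (simp add: arrival_order_def)

lemma length_arrival_order: "xs \<in> set_pmf (arrival_order N) \<Longrightarrow> length xs = N"
  by (simp add: set_pmf_arrival_order length_finite_permutations_of_set)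

lemma distinct_arrival_order: "xs \<in> set_pmf (arrival_order N) \<Longrightarrow> distinct xs"
  by (simp add: set_pmf_arrival_order permutations_of_set_def)

lemma prob_pmf_cong:
  assumes "\<And>x. x \<in> set_pmf p \<Longrightarrow> P x \<longleftrightarrow> Q x"
  shows "measure_pmf.prob p {x. P x} = measure_pmf.prob p {x. Q x}"
  using assms by (intro measure_pmf.finite_measure_eq_AE) (auto simp: AE_measure_pmf_iff)

text \<open>
  The last value determines the set of the others, whose orderings are in bijection with their
  standardizations; surjectivity then follows by counting.
\<close>

lemma standardize_take_last_bij_betw:
  "bij_betw (\<lambda>xs. (standardize (take n xs), xs ! n)) (permutations_of_set {1..Suc n})
     (permutations_of_set {1..n} \<times> {1..Suc n})"
proof -
  let ?f = "\<lambda>xs. (standardize (take n xs), xs ! n)"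
  have split: "xs = take n xs @ [xs ! n]" "xs ! n \<in> {1..Suc n}"
    "take n xs \<in> permutations_of_set ({1..Suc n} - {xs ! n})"
    if "xs \<in> permutations_of_set {1..Suc n}" for xs
  proof -
    have len: "length xs = Suc n"
      using that length_finite_permutations_of_set by fastforce
    then show *: "xs = take n xs @ [xs ! n]"
      by (metis lessI order_refl take_Suc_conv_app_nth take_all)
    have "set xs = {1..Suc n}" "distinct xs"
      using that by (auto simp: permutations_of_set_def)
    then have "set (take n xs @ [xs ! n]) = {1..Suc n}" "distinct (take n xs @ [xs ! n])"
      using * by simp_all
    then show "xs ! n \<in> {1..Suc n}"
      "take n xs \<in> permutations_of_set ({1..Suc n} - {xs ! n})"
      unfolding permutations_of_set_def by auto
  qed
  have bij: "bij_betw standardize (permutations_of_set ({1..Suc n} - {x})) (permutations_of_set {1..n})"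
    if "x \<in> {1..Suc n}" for x
    using standardize_bij_betw[of "{1..Suc n} - {x}"] that by simp
  have inj: "inj_on ?f (permutations_of_set {1..Suc n})"
  proof (rule inj_onI)
    fix xs ys assume *: "xs \<in> permutations_of_set {1..Suc n}" "ys \<in> permutations_of_set {1..Suc n}"
      "?f xs = ?f ys"
    then have "take n xs = take n ys"
      using split[OF *(1)] split[OF *(2)] bij_betw_imp_inj_on[OF bij]
      by (metis inj_onD prod.inject)
    then show "xs = ys"
      using * split(1) by (metis prod.inject)
  qed
  have "?f ` permutations_of_set {1..Suc n} = permutations_of_set {1..n} \<times> {1..Suc n}"
  proof (rule card_subset_eq)
    show "?f ` permutations_of_set {1..Suc n} \<subseteq> permutations_of_set {1..n} \<times> {1..Suc n}"
      using split(2) bij_betwE[OF bij[OF split(2)]] split(3) by blast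
    show "card (?f ` permutations_of_set {1..Suc n}) = card (permutations_of_set {1..n} \<times> {1..Suc n})"
      using inj by (simp add: card_image card_cartesian_product)
  qed simp
  with inj show ?thesis
    by (rule bij_betw_imageI)
qed

text \<open>A bijection preserves uniformity, and the uniform law on a product is a product law.
  This is the source of independence: the last value says nothing about the order of the earlier
  candidates.\<close>

lemma map_pmf_standardize_take_last:
  "map_pmf (\<lambda>xs. (standardize (take n xs), xs ! n)) (arrival_order (Suc n)) =
     pair_pmf (arrival_order n) (pmf_of_set {1..Suc n})"
proof -
  have "map_pmf (\<lambda>xs. (standardize (take n xs), xs ! n)) (arrival_order (Suc n)) =
      pmf_of_set (permutations_of_set {1..n} \<times> {1..Suc n})"
    unfolding arrival_order_def
    by (rule map_pmf_of_set_bij_betw[OF standardize_take_last_bij_betw]) simp_all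
  also have "\<dots> = pair_pmf (arrival_order n) (pmf_of_set {1..Suc n})"
    by (rule pmf_eqI) (auto simp: arrival_order_def pmf_pair indicator_def
        card_cartesian_product algebra_simps)
  finally show ?thesis .
qed

text \<open>Downward induction from \<open>N\<close>: each step drops the last candidate, and the
  first marginal of the product law is again uniform.\<close>

lemma map_pmf_standardize_take:
  assumes "n \<le> N"
  shows "map_pmf (\<lambda>xs. standardize (take n xs)) (arrival_order N) = arrival_order n"
  using assms
proof (induction rule: inc_induct)
  case base
  have "map_pmf (\<lambda>xs. standardize (take N xs)) (arrival_order N) = map_pmf standardize (arrival_order N)"
    by (intro map_pmf_cong) (simp_all add: length_arrival_order)
  also have "\<dots> = arrival_order N"
    unfolding arrival_order_def
    using standardize_bij_betw[of "{1..N}"] by (intro map_pmf_of_set_bij_betw) simp_all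
  finally show ?case .
next
  case (step n)
  have "map_pmf (\<lambda>xs. standardize (take n xs)) (arrival_order N) =
      map_pmf (\<lambda>xs. standardize (take n xs)) (map_pmf (\<lambda>xs. standardize (take (Suc n) xs)) (arrival_order N))"
    by (simp add: map_pmf_comp standardize_take_standardize)
  also have "\<dots> = map_pmf (\<lambda>xs. standardize (take n xs)) (arrival_order (Suc n))"
    by (simp add: step.IH)
  also have "\<dots> = map_pmf fst (map_pmf (\<lambda>xs. (standardize (take n xs), xs ! n)) (arrival_order (Suc n)))"
    by (simp add: map_pmf_comp)
  also have "\<dots> = arrival_order n"
    by (simp only: map_pmf_standardize_take_last map_fst_pair_pmf)
  finally show ?case .
qed

text \<open>The hypothesis on \<open>Q\<close> says that it depends only on the relative order of
  the first \<open>n\<close> entries. Restrict to \<open>n + 1\<close> candidates by standardizing,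
  split off the last value, and return from \<open>n\<close> to \<open>N\<close>.\<close>

lemma prob_record_at:
  assumes "n < N" and inv: "\<And>xs. n \<le> length xs \<Longrightarrow> Q (standardize (take n xs)) \<longleftrightarrow> Q xs"
  shows "measure_pmf.prob (arrival_order N) {xs. Q xs \<and> record_at xs n} =
    measure_pmf.prob (arrival_order N) {xs. Q xs} / (real n + 1)"
proof -
  have "measure_pmf.prob (arrival_order N) {xs. Q xs \<and> record_at xs n} =
      measure_pmf.prob (arrival_order N)
        {xs. Q (standardize (take (Suc n) xs)) \<and> record_at (standardize (take (Suc n) xs)) n}"
  proof (rule prob_pmf_cong)
    fix xs assume "xs \<in> set_pmf (arrival_order N)"
    then have len: "n < length xs"
      using assms length_arrival_order by simp
    moreover have "Q (standardize (take (Suc n) xs)) \<longleftrightarrow> Q xs"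
      using inv[of "standardize (take (Suc n) xs)"] inv[of xs]
      using len by (simp add: standardize_take_standardize)
    ultimately show "Q xs \<and> record_at xs n \<longleftrightarrow>
        Q (standardize (take (Suc n) xs)) \<and> record_at (standardize (take (Suc n) xs)) n"
      by (simp add: record_at_standardize record_at_take)
  qed
  also have "\<dots> = measure_pmf.prob (map_pmf (\<lambda>xs. standardize (take (Suc n) xs)) (arrival_order N))
      {xs. Q xs \<and> record_at xs n}"
    by simp
  also have "\<dots> = measure_pmf.prob (arrival_order (Suc n)) {xs. Q xs \<and> record_at xs n}"
    using assms by (simp only: map_pmf_standardize_take Suc_le_eq)
  \<comment> \<open>In an ordering of \<open>{1..Suc n}\<close> the last entry is a record iff it is
    \<open>Suc n\<close>; the event thus becomes a rectangle for the product law.\<close>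
  also have "\<dots> = measure_pmf.prob (arrival_order (Suc n))
      {xs. Q (standardize (take n xs)) \<and> xs ! n \<in> {Suc n}}"
  proof (rule prob_pmf_cong)
    fix xs assume xs: "xs \<in> set_pmf (arrival_order (Suc n))"
    then have "set xs = {1..Suc n}" "take (Suc n) xs = xs"
      by (auto simp: set_pmf_arrival_order permutations_of_set_def length_arrival_order)
    moreover have "Max {1..Suc n} = Suc n"
      by (rule Max_eqI) auto
    ultimately show "Q xs \<and> record_at xs n \<longleftrightarrow> Q (standardize (take n xs)) \<and> xs ! n \<in> {Suc n}"
      using inv[of xs] length_arrival_order[OF xs] by (simp add: record_at_def)
  qed
  also have "\<dots> = measure_pmf.prob (map_pmf (\<lambda>xs. (standardize (take n xs), xs ! n)) (arrival_order (Suc n)))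
      ({xs. Q xs} \<times> {Suc n})"
    by (simp add: vimage_def)
  also have "\<dots> = measure_pmf.prob (arrival_order n) {xs. Q xs} *
      measure_pmf.prob (pmf_of_set {1..Suc n}) {Suc n}"
    unfolding map_pmf_standardize_take_last by (rule measure_pmf_prob_product) auto
  also have "measure_pmf.prob (pmf_of_set {1..Suc n}) {Suc n} = 1 / (real n + 1)"
    by (simp add: measure_pmf_single)
  also have "measure_pmf.prob (arrival_order n) {xs. Q xs} =
      measure_pmf.prob (map_pmf (\<lambda>xs. standardize (take n xs)) (arrival_order N)) {xs. Q xs}"
    using assms by (simp only: map_pmf_standardize_take less_imp_le)
  also have "\<dots> = measure_pmf.prob (arrival_order N) {xs. Q xs}"
    unfolding measure_map_pmf vimage_Collect_eq mem_Collect_eq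
    using assms by (intro prob_pmf_cong inv) (simp add: length_arrival_order)
  finally show ?thesis
    by simp
qed

lemma prob_not_record_at:
  assumes "n < N" and inv: "\<And>xs. n \<le> length xs \<Longrightarrow> Q (standardize (take n xs)) \<longleftrightarrow> Q xs"
  shows "measure_pmf.prob (arrival_order N) {xs. Q xs \<and> \<not> record_at xs n} =
    measure_pmf.prob (arrival_order N) {xs. Q xs} * (real n / (real n + 1))"
proof -
  have "{xs. Q xs \<and> \<not> record_at xs n} = {xs. Q xs} - {xs. Q xs \<and> record_at xs n}"
    by auto
  then have "measure_pmf.prob (arrival_order N) {xs. Q xs \<and> \<not> record_at xs n} =
      measure_pmf.prob (arrival_order N) {xs. Q xs} -
      measure_pmf.prob (arrival_order N) {xs. Q xs \<and> record_at xs n}"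
    by (simp only:) (intro measure_pmf.finite_measure_Diff; auto)
  also have "\<dots> = measure_pmf.prob (arrival_order N) {xs. Q xs} * (real n / (real n + 1))"
    using prob_record_at[of n N Q, OF assms] by (simp add: field_simps)
  finally show ?thesis .
qed

text \<open>The two cases of \<open>selects_best_Suc\<close> are disjoint, and earlier success is
  independent of whether \<open>m\<close> is a record. The last summand is the quantity
  \<open>a m\<close> of the introduction.\<close>

lemma prob_selects_best_Suc:
  assumes "m < N"
  shows "measure_pmf.prob (arrival_order N) {xs. selects_best d (Suc m) xs} =
    measure_pmf.prob (arrival_order N) {xs. selects_best d m xs} * (real m / (real m + 1)) +
    measure_pmf.prob (arrival_order N) {xs. selects d xs m \<and> record_at xs m}"
proof -
  have "measure_pmf.prob (arrival_order N) {xs. selects_best d (Suc m) xs} =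
      measure_pmf.prob (arrival_order N)
        {xs. (selects_best d m xs \<and> \<not> record_at xs m) \<or> (selects d xs m \<and> record_at xs m)}"
    using assms by (intro prob_pmf_cong selects_best_Suc distinct_arrival_order)
      (auto dest: length_arrival_order)
  also have "\<dots> = measure_pmf.prob (arrival_order N) {xs. selects_best d m xs \<and> \<not> record_at xs m} +
      measure_pmf.prob (arrival_order N) {xs. selects d xs m \<and> record_at xs m}"
    by (subst measure_pmf.finite_measure_Union[symmetric]) (auto intro!: arg_cong[where f = "measure _"])
  finally show ?thesis
    using prob_not_record_at[OF assms, of "selects_best d m"]
    by (simp add: selects_best_standardize_take)
qed

lemma prob_selects_best_0: "measure_pmf.prob p {xs. selects_best d 0 xs} = 0"
  by (simp add: selects_best_def)

subsection \<open>The upper bound\<close>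

lemma divide_add_mult_divide_cancel:
  assumes "r \<ge> 0"
  shows "x / (r + 1) + x * (r / (r + 1)) = (x :: real)"
proof -
  have "r + 1 \<noteq> 0"
    using assms by linarith
  then show ?thesis
    by (simp add: add_divide_distrib[symmetric] distrib_left[symmetric] divide_eq_eq)
      (simp add: algebra_simps)
qed

text \<open>Unrolls the recurrence. Bounding by the probability of having selected anyone so far,
  rather than by 1, leaves room in the induction for the next selection.\<close>

lemma weighted_prob_selects_best_le:
  assumes "m < N"
  shows "(\<Sum>n=1..m. measure_pmf.prob (arrival_order N) {xs. selects_best d n xs} / (real n + 1)) +
      measure_pmf.prob (arrival_order N) {xs. selects_best d (Suc m) xs}
    \<le> measure_pmf.prob (arrival_order N) {xs. \<exists>t<Suc m. selects d xs t}"
  using assms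
proof (induction m)
  case 0
  show ?case
    by (auto intro!: measure_pmf.finite_measure_mono simp: selects_best_def)
next
  case (Suc m)
  let ?P = "measure_pmf.prob (arrival_order N)"
  \<comment> \<open>At most one candidate is selected, so the next selection event is disjoint from
    the earlier ones.\<close>
  have "?P {xs. \<exists>t<Suc m. selects d xs t} + ?P {xs. selects d xs (Suc m) \<and> record_at xs (Suc m)}
     = ?P ({xs. \<exists>t<Suc m. selects d xs t} \<union> {xs. selects d xs (Suc m) \<and> record_at xs (Suc m)})"
    by (intro measure_pmf.finite_measure_Union[symmetric]) (auto simp: selects_def)
  also have "\<dots> \<le> ?P {xs. \<exists>t<Suc (Suc m). selects d xs t}"
    by (intro measure_pmf.finite_measure_mono) (auto simp: less_Suc_eq)
  finally have *: "?P {xs. \<exists>t<Suc m. selects d xs t} +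
      ?P {xs. selects d xs (Suc m) \<and> record_at xs (Suc m)}
    \<le> ?P {xs. \<exists>t<Suc (Suc m). selects d xs t}" .
  \<comment> \<open>The weight of the newest summand and the factor from the recurrence add up to 1,
    so together they restore the last term of the induction hypothesis.\<close>
  from divide_add_mult_divide_cancel[of "real (Suc m)" "?P {xs. selects_best d (Suc m) xs}"] Suc * show ?case
    using prob_selects_best_Suc[OF Suc.prems, of d] by (simp add: algebra_simps)
qed

text \<open>Fubini over the seed: success is the average of deterministic success probabilities, so
  linear bounds valid for each seed carry over.\<close>

lemma success_prob_eq_integral:
  fixes A :: "'w \<Rightarrow> nat list \<Rightarrow> bool"
  assumes "randomized_algorithm M A"
  shows "integrable M (\<lambda>w. measure_pmf.prob (arrival_order N) {xs. selects_best (A w) n xs})"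
    and "success_prob N M A n =
      (\<integral>w. measure_pmf.prob (arrival_order N) {xs. selects_best (A w) n xs} \<partial>M)"
proof -
  let ?X = "{(w, xs). w \<in> space M \<and> selects_best (A w) n xs}"
  let ?f = "\<lambda>w. measure_pmf.prob (arrival_order N) {xs. selects_best (A w) n xs}"
  interpret prob_space M
    using assms by (simp add: randomized_algorithm_def)
  have X: "?X \<in> sets (M \<Otimes>\<^sub>M measure_pmf (arrival_order N))"
    by (rule success_event_measurable[OF assms])
  have vim: "Pair w -` ?X = {xs. selects_best (A w) n xs}" if "w \<in> space M" for w
    using that by auto
  have "(\<lambda>w. measure_pmf.prob (arrival_order N) (Pair w -` ?X)) \<in> borel_measurable M"
    unfolding measure_def
    by (intro borel_measurable_enn2real measure_pmf.measurable_emeasure_Pair X)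
  also have "?this \<longleftrightarrow> ?f \<in> borel_measurable M"
    by (intro measurable_cong) (simp add: vim)
  finally have meas: "?f \<in> borel_measurable M" .
  show int: "integrable M ?f"
    by (rule integrable_const_bound[of _ 1]) (use meas in auto)
  have "emeasure (M \<Otimes>\<^sub>M measure_pmf (arrival_order N)) ?X =
      (\<integral>\<^sup>+w. emeasure (measure_pmf (arrival_order N)) (Pair w -` ?X) \<partial>M)"
    by (rule measure_pmf.emeasure_pair_measure_alt[OF X])
  also have "\<dots> = (\<integral>\<^sup>+w. ennreal (?f w) \<partial>M)"
    by (intro nn_integral_cong) (simp add: vim measure_pmf.emeasure_eq_measure)
  also have "\<dots> = ennreal (\<integral>w. ?f w \<partial>M)"
    by (rule nn_integral_eq_integral[OF int]) simp
  finally show "success_prob N M A n = (\<integral>w. ?f w \<partial>M)"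
    by (simp add: success_prob_def measure_def)
qed

text \<open>The summands run from \<open>1/2\<close> to \<open>1/(m+1)\<close>; the added 1 is the
  first harmonic term, and in the upper bound it is the weight of the last success
  probability.\<close>

lemma sum_divide_Suc_eq_harm: "(\<Sum>n=1..m. 1 / (real n + 1)) + 1 = (harm (Suc m) :: real)"
  by (induction m) (simp_all add: harm_Suc harm_expand divide_inverse add_ac)

theorem success_prob_upper_bound:
  assumes "randomized_algorithm M A" "N \<ge> 1"
  shows "\<exists>n\<in>{1..N}. success_prob N M A n \<le> 1 / harm N"
proof (rule ccontr)
  assume "\<not> ?thesis"
  then have gt: "success_prob N M A n > 1 / harm N" if "n \<in> {1..N}" for n
    using that by (meson not_le)
  obtain m where N: "N = Suc m"
    using \<open>N \<ge> 1\<close> by (cases N) auto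
  interpret prob_space M
    using assms by (simp add: randomized_algorithm_def)
  let ?S = "\<lambda>n w. measure_pmf.prob (arrival_order N) {xs. selects_best (A w) n xs}"
  note int = success_prob_eq_integral(1)[OF assms(1)]
  have "harm N > (0::real)"
    using \<open>N \<ge> 1\<close> by (intro harm_pos) simp
  then have "harm N \<noteq> (0::real)"
    by (rule less_imp_neq[THEN not_sym])
  then have "1 = harm N * (1 / harm N :: real)"
    by simp
  also have "\<dots> = (\<Sum>n=1..m. (1 / harm N) / (real n + 1)) + 1 / harm N"
  proof -
    have "c * r = (\<Sum>n=1..m. r / (real n + 1)) + r"
      if "c = (\<Sum>n=1..m. 1 / (real n + 1)) + 1" for c r :: real
      by (simp add: that distrib_right sum_distrib_right)
    from this[OF sum_divide_Suc_eq_harm[symmetric]] show ?thesis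
      by (simp only: N)
  qed
  \<comment> \<open>Strictness comes from the final term alone, so \<open>N = 1\<close>, where the
    sum is empty, is covered.\<close>
  also have "\<dots> < (\<Sum>n=1..m. success_prob N M A n / (real n + 1)) + success_prob N M A (Suc m)"
    by (intro add_le_less_mono sum_mono divide_right_mono less_imp_le gt) (auto simp: N)
  also have "\<dots> = (\<integral>w. (\<Sum>n=1..m. ?S n w / (real n + 1)) + ?S (Suc m) w \<partial>M)"
    using int by (simp add: success_prob_eq_integral(2)[OF assms(1)])
  also have "\<dots> \<le> (\<integral>w. 1 \<partial>M)"
  proof (intro integral_mono)
    fix w
    show "(\<Sum>n=1..m. ?S n w / (real n + 1)) + ?S (Suc m) w \<le> 1"
      by (rule order_trans[OF weighted_prob_selects_best_le]) (simp_all add: N)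
  qed (use int in auto)
  also have "\<dots> = 1"
    by (simp add: prob_space)
  finally show False
    by simp
qed

subsection \<open>The algorithm\<close>

definition skip_pmf :: "nat \<Rightarrow> nat pmf" where
  "skip_pmf N = embed_pmf (\<lambda>k. if k = 0 then 1 / (harm (N - 1) + 1)
     else if k < N then 1 / (harm (N - 1) + 1) / k else 0)"

text \<open>\<open>last h = 1\<close> recognizes a record and \<open>w < length h\<close> skips the
  first \<open>w\<close> candidates; stopping at the first such record comes from
  \<open>selects\<close>. The seed is real to match the seed type in the final theorem.\<close>

definition first_record_after :: "real \<Rightarrow> nat list \<Rightarrow> bool" where
  "first_record_after w h \<longleftrightarrow> w < length h \<and> last h = 1"

lemma pmf_skip_pmf:
  assumes "N \<ge> 1"
  shows "pmf (skip_pmf N) k = (if k = 0 then 1 / (harm (N - 1) + 1)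
     else if k < N then 1 / (harm (N - 1) + 1) / k else 0)"
proof -
  define p :: real where "p = 1 / (harm (N - 1) + 1)"
  let ?f = "\<lambda>k. if k = 0 then p else if k < N then p / real k else 0"
  have "harm (N - 1) + 1 > (0::real)"
    using harm_nonneg[of "N - 1", where 'a = real] by linarith
  then have p: "p \<ge> 0" "p * (harm (N - 1) + 1) = 1"
    by (simp_all add: p_def)
  have nonneg: "?f k \<ge> 0" for k
    using p by simp
  have "(\<integral>\<^sup>+k. ennreal (?f k) \<partial>count_space UNIV) = (\<Sum>k\<in>{..<N}. ennreal (?f k))"
    using assms by (intro nn_integral_count_space') auto
  also have "\<dots> = ennreal (\<Sum>k\<in>{..<N}. ?f k)"
    using nonneg by (rule sum_ennreal)
  also have "{..<N} = insert 0 {1..N - 1}"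
    using assms by auto
  also have "(\<Sum>k\<in>insert 0 {1..N - 1}. ?f k) = p + (\<Sum>k=1..N - 1. p / k)"
    by (subst sum.insert) (auto intro!: sum.cong)
  also have "\<dots> = p * (harm (N - 1) + 1)"
    by (simp add: harm_def sum_distrib_left divide_inverse algebra_simps)
  also have "\<dots> = 1"
    by (rule p)
  finally show ?thesis
    unfolding skip_pmf_def p_def[symmetric] using nonneg by (subst pmf_embed_pmf) auto
qed

text \<open>The factors \<open>s / (s + 1)\<close> for \<open>s\<close> from \<open>k\<close> to
  \<open>t - 1\<close> telescope to \<open>k / t\<close>. The product form includes
  \<open>t = 0\<close>.\<close>

lemma prob_no_record_between:
  assumes "k \<le> t" "t \<le> N"
  shows "measure_pmf.prob (arrival_order N) {xs. \<forall>s\<in>{k..<t}. \<not> record_at xs s} * t = k"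
  using assms
proof (induction rule: dec_induct)
  case base
  then show ?case by simp
next
  case (step t)
  let ?Q = "\<lambda>t xs. \<forall>s\<in>{k..<t}. \<not> record_at xs s"
  have inv: "?Q t (standardize (take t xs)) \<longleftrightarrow> ?Q t xs" if "t \<le> length xs" for xs
    using that by (auto simp: record_at_standardize record_at_take)
  have "?Q (Suc t) xs \<longleftrightarrow> ?Q t xs \<and> \<not> record_at xs t" for xs
    using step.hyps by (auto simp: less_Suc_eq)
  then have "measure_pmf.prob (arrival_order N) {xs. ?Q (Suc t) xs} =
      measure_pmf.prob (arrival_order N) {xs. ?Q t xs} * (real t / (real t + 1))"
    using prob_not_record_at[of t N "?Q t"] inv step.prems by simp
  then show ?case
    using step by (simp add: add.commute)
qed

lemma selects_first_record_after:
  "selects (first_record_after (real k)) xs t \<longleftrightarrow>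
     t < length xs \<and> k \<le> t \<and> record_at xs t \<and> (\<forall>s\<in>{k..<t}. \<not> record_at xs s)"
proof -
  have "first_record_after (real k) (rel_ranks (take (Suc s) xs)) \<longleftrightarrow> k \<le> s \<and> record_at xs s"
    if "s < length xs" for s
    using that last_rel_ranks_eq_1_iff[OF that]
    by (auto simp: first_record_after_def rel_ranks_def less_Suc_eq_le)
  then show ?thesis
    unfolding selects_def by (cases "t < length xs") auto
qed

text \<open>Candidate \<open>m\<close> is chosen when it is a record and no record fell in
  \<open>{k..<m}\<close>, an event of the first \<open>m\<close> entries. The case
  \<open>m = 0\<close> is separate: the quotient would be 0 by the convention on division, but the
  first candidate is always a record.\<close>

lemma prob_selects_record_first_record_after:
  assumes "m < N"
  shows "measure_pmf.prob (arrival_order N)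
      {xs. selects (first_record_after (real k)) xs m \<and> record_at xs m} =
    (if k \<le> m then if m = 0 then 1 else k / (real m * (real m + 1)) else 0)"
proof (cases "k \<le> m")
  case True
  let ?Q = "\<lambda>xs. \<forall>s\<in>{k..<m}. \<not> record_at xs s"
  have inv: "?Q (standardize (take m xs)) \<longleftrightarrow> ?Q xs" if "m \<le> length xs" for xs
    using that by (auto simp: record_at_standardize record_at_take)
  have "measure_pmf.prob (arrival_order N)
      {xs. selects (first_record_after (real k)) xs m \<and> record_at xs m} =
    measure_pmf.prob (arrival_order N) {xs. ?Q xs \<and> record_at xs m}"
    using True assms
    by (intro prob_pmf_cong) (auto simp: selects_first_record_after length_arrival_order)
  also have "\<dots> = measure_pmf.prob (arrival_order N) {xs. ?Q xs} / (real m + 1)"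
    by (intro prob_record_at inv assms)
  also have "\<dots> = (if m = 0 then 1 else k / (real m * (real m + 1)))"
  proof (cases "m = 0")
    case False
    then have "measure_pmf.prob (arrival_order N) {xs. ?Q xs} = k / m"
      using prob_no_record_between[OF True, of N] assms by (simp add: eq_divide_eq)
    then show ?thesis
      using False by (simp add: add.commute)
  qed simp
  finally show ?thesis
    using True by simp
qed (simp add: selects_first_record_after)

text \<open>The weight \<open>p / k\<close> cancels the factor \<open>k\<close>, leaving
  \<open>m\<close> equal terms \<open>p / (m * (m + 1))\<close> for \<open>k\<close> in
  \<open>{1..m}\<close>. For \<open>m > 0\<close> the value \<open>k = 0\<close> contributes
  nothing; for \<open>m = 0\<close> only it does.\<close>

lemma sum_skip_pmf_selects_record:
  assumes "m < N"
  shows "(\<Sum>k<N. pmf (skip_pmf N) k * measure_pmf.prob (arrival_order N)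
      {xs. selects (first_record_after (real k)) xs m \<and> record_at xs m}) =
    1 / (harm (N - 1) + 1) / (m + 1)"
proof -
  define p :: real where "p = 1 / (harm (N - 1) + 1)"
  let ?a = "\<lambda>k. measure_pmf.prob (arrival_order N)
      {xs. selects (first_record_after (real k)) xs m \<and> record_at xs m}"
  have pmf: "pmf (skip_pmf N) k = (if k = 0 then p else if k < N then p / k else 0)" for k
    using assms pmf_skip_pmf[of N k] by (simp add: p_def)
  have "(\<Sum>k<N. pmf (skip_pmf N) k * ?a k) =
      (\<Sum>k\<in>(if m = 0 then {0} else {1..m}). p / (if m = 0 then 1 else real m * (real m + 1)))"
    using assms
    by (intro sum.mono_neutral_cong_right)
      (auto simp: pmf prob_selects_record_first_record_after split: if_splits)
  also have "\<dots> = p / (m + 1)"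
    by simp
  finally show ?thesis
    by (simp add: p_def)
qed

text \<open>The value \<open>p\<close> is a fixed point of the averaged recurrence, and the case of
  a single candidate starts it there.\<close>

lemma sum_skip_pmf_selects_best:
  assumes "n < N"
  shows "(\<Sum>k<N. pmf (skip_pmf N) k * measure_pmf.prob (arrival_order N)
      {xs. selects_best (first_record_after (real k)) (Suc n) xs}) = 1 / (harm (N - 1) + 1)"
  using assms
proof (induction n)
  case 0
  then show ?case
    using sum_skip_pmf_selects_record[of 0 N]
    by (simp add: prob_selects_best_Suc prob_selects_best_0)
next
  case (Suc n)
  define p :: real where "p = 1 / (harm (N - 1) + 1)"
  have "(\<Sum>k<N. pmf (skip_pmf N) k * measure_pmf.prob (arrival_order N)
      {xs. selects_best (first_record_after (real k)) (Suc (Suc n)) xs}) =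
    p * (real (Suc n) / (real (Suc n) + 1)) + p / (real (Suc n) + 1)"
    using Suc.IH Suc.prems sum_skip_pmf_selects_record[of "Suc n" N]
    by (simp only: prob_selects_best_Suc distrib_left sum.distrib mult.assoc[symmetric]
        sum_distrib_right[symmetric] p_def)
  also have "\<dots> = p"
    using divide_add_mult_divide_cancel[of "real (Suc n)" p] by simp
  finally show ?case
    by (simp add: p_def)
qed

theorem success_prob_first_record_after:
  fixes n N :: nat
  defines "M \<equiv> measure_pmf (map_pmf real (skip_pmf N))"
  assumes "n \<in> {1..N}"
  shows "randomized_algorithm M first_record_after"
    and "success_prob N M first_record_after n = 1 / (harm (N - 1) + 1)"
proof -
  show alg: "randomized_algorithm M first_record_after"
    by (simp add: randomized_algorithm_def M_def measure_pmf.prob_space_axioms)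
  obtain m where m: "n = Suc m" "m < N"
    using assms by (cases n) auto
  have "success_prob N M first_record_after n =
    (\<integral>k. measure_pmf.prob (arrival_order N) {xs. selects_best (first_record_after (real k)) n xs}
       \<partial>measure_pmf (skip_pmf N))"
    unfolding success_prob_eq_integral(2)[OF alg] unfolding M_def by simp
  also have "\<dots> = (\<Sum>k<N. pmf (skip_pmf N) k * measure_pmf.prob (arrival_order N)
      {xs. selects_best (first_record_after (real k)) n xs})"
    using m by (subst integral_measure_pmf_real[of "{..<N}"])
      (auto simp: set_pmf_iff pmf_skip_pmf mult.commute split: if_splits)
  also have "\<dots> = 1 / (harm (N - 1) + 1)"
    using m sum_skip_pmf_selects_best by simp
  finally show "success_prob N M first_record_after n = 1 / (harm (N - 1) + 1)" .
qed

theorem theorem5: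
  fixes N :: nat
  assumes "N \<ge> 1"
  shows "(\<exists>(M :: real measure) A. randomized_algorithm M A \<and>
            (\<forall>n\<in>{1..N}. success_prob N M A n \<ge> 1 / (harm (N - 1) + 1))) \<and>
         (\<forall>(M :: 'w measure) A. randomized_algorithm M A \<longrightarrow>
            \<not> (\<forall>n\<in>{1..N}. success_prob N M A n > 1 / harm N))"
proof (intro conjI allI impI)
  show "\<exists>(M :: real measure) A. randomized_algorithm M A \<and>
      (\<forall>n\<in>{1..N}. success_prob N M A n \<ge> 1 / (harm (N - 1) + 1))"
    \<comment> \<open>\<open>N \<ge> 1\<close> makes the range of \<open>n\<close> nonempty, which
      gives access to the first conclusion of
      \<open>success_prob_first_record_after\<close>.\<close>
    using assms success_prob_first_record_after[of _ N]
    by (intro exI[of _ "measure_pmf (map_pmf real (skip_pmf N))"] exI[of _ first_record_after]) force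
  show "\<not> (\<forall>n\<in>{1..N}. success_prob N M A n > 1 / harm N)"
    if "randomized_algorithm M A" for M :: "'w measure" and A
    using success_prob_upper_bound[OF that assms] by (auto simp: not_less)
qed

end
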